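(* Let $A$ and $B$ be finite sets of UTVPI constraints with integer constants, such that $A\wedge B$ is satisfiable over $\mathbb Q$ but unsatisfiable over $\mathbb Z$. Let $A',B'$ be their difference-logic encodings and let $C$ be a cycle of total weight $0$ in the constraint graph $G(A'\wedge B')$ (each edge labelled as coming from $A'$ or from $B'$; write $C_A$, $C_B$ for the $A'$- and $B'$-edges of $C$) that contains, each exactly once, the two vertices $x_i^+$ and $x_i^-$ of some variable $x_i$, such that the weight of the path from $x_i^-$ to $x_i^+$ along $C$ is odd. Suppose $x_i$ occurs in $B$ but not in $A$. Let $I'$ be the conjunction of the summary constraints of the maximal $C_A$-paths of $C$, and $I=\Upsilon(I')$. Then $I$ is an interpolant for $(A,B)$ over the integers.
   Context: A UTVPI constraint is $(0\le a x + b y + k)$ with $a,b\in\{-1,0,1\}$. For each variable $x$ there are difference-logic variables $x^+,x^-$, with $\Upsilon(x^+)=x$, $\Upsilon(x^-)=-x$; write $v(x)=x^+$, $v(-x)=x^-$ for signed variables. Encoding: $(0\le s_1+s_2+k)$ with $s_1,s_2$ signed occurrences of distinct variables becomes $(0\le v(s_1)-v(-s_2)+k)$ and $(0\le v(s_2)-v(-s_1)+k)$; $(0\le s+k)$ becomes $(0\le v(s)-v(-s)+2k)$. $\Upsilon(0\le v-u+k)=(0\le\Upsilon(v)-\Upsilon(u)+k)$, extended to conjunctions. The graph has an edge $u\xrightarrow{c}v$ per constraint $(0\le v-u+c)$. A maximal $C_A$-path is a maximal path $u_1\xrightarrow{c_1}\cdots\xrightarrow{c_{n-1}}u_n$ of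 consecutive $C_A$-edges of $C$ preceded and followed in $C$ by $C_B$-edges; its summary constraint is $(0\le u_n-u_1+\sum c_j)$. An interpolant for $(A,B)$ over the integers is a formula $I$ with $A\models I$ and $I\wedge B$ unsatisfiable (variables ranging over $\mathbb Z$), and every variable of $I$ occurring in both $A$ and $B$. *)

theory Defs
  imports "Graph_Theory.Arc_Walk"
begin

datatype 'a signed = Pos 'a | Neg 'a

fun neg :: "'a signed \<Rightarrow> 'a signed" where
  "neg (Pos x) = Neg x"
| "neg (Neg x) = Pos x"

fun var_of :: "'a signed \<Rightarrow> 'a" where
  "var_of (Pos x) = x"
| "var_of (Neg x) = x"

fun sval :: "('a \<Rightarrow> 'r::linordered_idom) \<Rightarrow> 'a signed \<Rightarrow> 'r" where
  "sval \<sigma> (Pos x) = \<sigma> x"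
| "sval \<sigma> (Neg x) = - \<sigma> x"

text \<open>
  Atomic constraints over the original variables: \<open>Two s t k\<close> is \<open>0 \<le> s + t + k\<close>,
  \<open>One s k\<close> is \<open>0 \<le> s + k\<close>, and \<open>Const k\<close> is \<open>0 \<le> k\<close> (the case \<open>a = b = 0\<close> of
  \<open>0 \<le> a x + b y + k\<close>).  The type is slightly larger than the UTVPI constraints: in
  \<open>Two s t k\<close> both occurrences may be of the same variable, as in \<open>0 \<le> x + x + k\<close>, which is
  needed for the images of difference constraints under \<open>Upsilon\<close>.
  The UTVPI constraints are singled out by \<open>utvpi\<close>.
\<close>

datatype 'a constr = Two "'a signed" "'a signed" int | One "'a signed" int | Const int

fun utvpi :: "'a constr \<Rightarrow> bool" where
  "utvpi (Two s t k) = (var_of s \<noteq> var_of t)"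
| "utvpi (One s k) = True"
| "utvpi (Const k) = True"

fun holds :: "('a \<Rightarrow> 'r::linordered_idom) \<Rightarrow> 'a constr \<Rightarrow> bool" where
  "holds \<sigma> (Two s t k) = (0 \<le> sval \<sigma> s + sval \<sigma> t + of_int k)"
| "holds \<sigma> (One s k) = (0 \<le> sval \<sigma> s + of_int k)"
| "holds \<sigma> (Const k) = (0 \<le> (of_int k :: 'r))"

text \<open>Syntactic occurrence: the variable \<open>x\<close> occurs in \<open>0 \<le> x - x + k\<close>.\<close>

fun cvars :: "'a constr \<Rightarrow> 'a set" where
  "cvars (Two s t k) = {var_of s, var_of t}"
| "cvars (One s k) = {var_of s}"
| "cvars (Const k) = {}"

text \<open>A conjunction of constraints is the set of its conjuncts.\<close>

definition models :: "('a \<Rightarrow> 'r::linordered_idom) \<Rightarrow> 'a constr set \<Rightarrow> bool" where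
  "models \<sigma> F \<longleftrightarrow> (\<forall>c\<in>F. holds \<sigma> c)"

definition vars :: "'a constr set \<Rightarrow> 'a set" where
  "vars F = (\<Union>c\<in>F. cvars c)"

text \<open>Finiteness of \<open>I\<close> makes it a genuine (finite) formula.\<close>

definition int_interpolant :: "'a constr set \<Rightarrow> 'a constr set \<Rightarrow> 'a constr set \<Rightarrow> bool" where
  "int_interpolant A B I \<longleftrightarrow>
     finite I \<and>
     (\<forall>\<sigma> :: 'a \<Rightarrow> int. models \<sigma> A \<longrightarrow> models \<sigma> I) \<and>
     \<not> (\<exists>\<sigma> :: 'a \<Rightarrow> int. models \<sigma> (I \<union> B)) \<and>
     vars I \<subseteq> vars A \<inter> vars B"

text \<open>Difference-logic variables \<open>x\<^sup>+\<close>, \<open>x\<^sup>-\<close>; \<open>DC v u k\<close> is the constraint \<open>0 \<le> v - u + k\<close>.\<close>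

datatype 'a dvar = Plus 'a | Minus 'a

datatype 'a dconstr = DC (target: "'a dvar") (source: "'a dvar") (weight: int)

fun dv :: "'a signed \<Rightarrow> 'a dvar" where
  "dv (Pos x) = Plus x"
| "dv (Neg x) = Minus x"

fun Upsilon_var :: "'a dvar \<Rightarrow> 'a signed" where
  "Upsilon_var (Plus x) = Pos x"
| "Upsilon_var (Minus x) = Neg x"

fun Upsilon_constr :: "'a dconstr \<Rightarrow> 'a constr" where
  "Upsilon_constr (DC v u k) = Two (Upsilon_var v) (neg (Upsilon_var u)) k"

definition Upsilon :: "'a dconstr set \<Rightarrow> 'a constr set" where
  "Upsilon F = Upsilon_constr ` F"

text \<open>
  A variable-free constraint contributes no difference constraint.  This loses nothing for
  rationally satisfiable systems, where such a constraint is trivially true.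
\<close>

fun encode_constr :: "'a constr \<Rightarrow> 'a dconstr set" where
  "encode_constr (Two s t k) = {DC (dv s) (dv (neg t)) k, DC (dv t) (dv (neg s)) k}"
| "encode_constr (One s k) = {DC (dv s) (dv (neg s)) (2 * k)}"
| "encode_constr (Const k) = {}"

definition encode :: "'a constr set \<Rightarrow> 'a dconstr set" where
  "encode F = (\<Union>c\<in>F. encode_constr c)"

text \<open>
  An arc is a difference constraint together with the side it comes from; a constraint occurring
  on both sides yields two parallel arcs.
\<close>

datatype side = From_A | From_B

type_synonym 'a arc = "side \<times> 'a dconstr"

definition constraint_graph ::
    "'a dconstr set \<Rightarrow> 'a dconstr set \<Rightarrow> ('a dvar, 'a arc) pre_digraph" where
  "constraint_graph A' B' =
     \<lparr> verts = source ` (A' \<union> B') \<union> target ` (A' \<union> B'),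
       arcs = {From_A} \<times> A' \<union> {From_B} \<times> B',
       tail = (\<lambda>e. source (snd e)),
       head = (\<lambda>e. target (snd e)) \<rparr>"

definition walk_weight :: "'a arc list \<Rightarrow> int" where
  "walk_weight p = (\<Sum>e\<leftarrow>p. weight (snd e))"

text \<open>
  Cycles are closed walks given by their arc lists from some base vertex.  \<open>p\<close> is a path along
  the cycle \<open>C\<close> with remainder \<open>q\<close>: starting \<open>C\<close> at a suitable vertex, one first traverses \<open>p\<close>
  and then \<open>q\<close>.
\<close>

definition splits_cycle :: "'a arc list \<Rightarrow> 'a arc list \<Rightarrow> 'a arc list \<Rightarrow> bool" where
  "splits_cycle C p q \<longleftrightarrow> (\<exists>m. rotate m C = p @ q)"

definition visits_once :: "'a arc list \<Rightarrow> 'a dvar \<Rightarrow> bool" where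
  "visits_once C v \<longleftrightarrow> count_list (map (\<lambda>e. source (snd e)) C) v = 1"

definition maximal_A_path :: "'a arc list \<Rightarrow> 'a arc list \<Rightarrow> bool" where
  "maximal_A_path C p \<longleftrightarrow>
     p \<noteq> [] \<and> (\<forall>e\<in>set p. fst e = From_A) \<and>
     (\<exists>q. splits_cycle C p q \<and> q \<noteq> [] \<and> fst (hd q) = From_B \<and> fst (last q) = From_B)"

definition summary_constr :: "'a arc list \<Rightarrow> 'a dconstr" where
  "summary_constr p = DC (target (snd (last p))) (source (snd (hd p))) (walk_weight p)"

end

theory Submission
  imports Defs
begin

text \<open>
  An integer assignment \<open>\<sigma>\<close> gives the difference variables \<open>x\<^sup>+\<close>, \<open>x\<^sup>-\<close> the potentials
  \<open>\<sigma> x\<close> and \<open>- \<sigma> x\<close>, and the slacks of the arcs of a walk telescope.  As \<open>x\<close> does not occur in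
  \<open>A\<close>, both arcs of \<open>C\<close> at each of \<open>x\<^sup>+\<close> and \<open>x\<^sup>-\<close> come from \<open>B\<close>, so no maximal
  \<open>A\<close>-path crosses these vertices.  A model of \<open>I \<and> B\<close> therefore gives nonnegative slack to
  both halves of the cycle, that is \<open>0 \<le> 2 x + w\<close> and \<open>0 \<le> - 2 x - w\<close> where \<open>w\<close> is the odd
  weight of \<open>P\<close>; hence \<open>2 x = - w\<close>, which no integer satisfies.
\<close>

section \<open>Signed variables, potentials and slack\<close>

lemma sval_neg [simp]: "sval \<sigma> (neg s) = - sval \<sigma> s"
  by (cases s) auto

lemma var_of_neg [simp]: "var_of (neg s) = var_of s"
  by (cases s) auto

lemma Upsilon_var_dv [simp]: "Upsilon_var (dv s) = s"
  by (cases s) auto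

abbreviation potential :: "('a \<Rightarrow> int) \<Rightarrow> 'a dvar \<Rightarrow> int" where
  "potential \<sigma> v \<equiv> sval \<sigma> (Upsilon_var v)"

text \<open>The value of the difference constraint under the assignment; in graph terms, the reduced
  cost of the arc with respect to \<open>potential \<sigma>\<close>.\<close>

definition slack :: "('a \<Rightarrow> int) \<Rightarrow> 'a dconstr \<Rightarrow> int" where
  "slack \<sigma> d = potential \<sigma> (target d) - potential \<sigma> (source d) + weight d"

abbreviation walk_slack :: "('a \<Rightarrow> int) \<Rightarrow> 'a arc list \<Rightarrow> int" where
  "walk_slack \<sigma> p \<equiv> (\<Sum>e\<leftarrow>p. slack \<sigma> (snd e))"

lemma holds_Upsilon_constr_iff: "holds \<sigma> (Upsilon_constr d) \<longleftrightarrow> 0 \<le> slack \<sigma> d"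
  by (cases d) (simp add: slack_def)

text \<open>Every arc encoding a two-variable constraint has the value of that constraint as its
  slack; the arc of a one-variable constraint has twice the value, which is why its weight is
  doubled.\<close>

lemma slack_encode_nonneg:
  assumes "models \<sigma> F" and "d \<in> encode F"
  shows "0 \<le> slack \<sigma> d"
proof -
  obtain c where c: "c \<in> F" "d \<in> encode_constr c"
    using assms(2) by (auto simp: encode_def)
  with assms(1) have "holds \<sigma> c"
    by (simp add: models_def)
  with c(2) show ?thesis
    by (cases c) (auto simp: slack_def)
qed

lemma vars_encode:
  assumes "d \<in> encode F"
  shows "var_of (Upsilon_var (source d)) \<in> vars F"
    and "var_of (Upsilon_var (target d)) \<in> vars F"
proof -
  obtain c where c: "c \<in> F" "d \<in> encode_constr c"
    using assms by (auto simp: encode_def)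
  then have "{var_of (Upsilon_var (source d)), var_of (Upsilon_var (target d))} \<subseteq> cvars c"
    by (cases c) auto
  with c(1) show "var_of (Upsilon_var (source d)) \<in> vars F"
    and "var_of (Upsilon_var (target d)) \<in> vars F"
    by (auto simp: vars_def)
qed

section \<open>Walks in the constraint graph\<close>

lemma wf_constraint_graph: "wf_digraph (constraint_graph A' B')"
  by unfold_locales (auto simp: constraint_graph_def)

lemma constraint_graph_simps [simp]:
  "tail (constraint_graph A' B') e = source (snd e)"
  "head (constraint_graph A' B') e = target (snd e)"
  "arcs (constraint_graph A' B') = {From_A} \<times> A' \<union> {From_B} \<times> B'"
  by (simp_all add: constraint_graph_def)

lemma (in wf_digraph) awalk_endpoints:
  assumes "awalk u p v" and "p \<noteq> []"
  shows "tail G (hd p) = u" and "head G (last p) = v"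
  using assms by (induction p arbitrary: u) (auto simp: awalk_Cons_iff split: if_splits)

text \<open>Cutting the closed walk after \<open>k\<close> arcs gives two walks that can be joined
  in the opposite order, because the second ends where the first starts.\<close>

lemma (in wf_digraph) closed_w_rotate:
  assumes "closed_w C"
  shows "\<exists>u. awalk u (rotate m C) u"
proof -
  define k where "k = m mod length C"
  obtain u where "awalk u (take k C @ drop k C) u"
    using assms by (auto simp: closed_w_def)
  then have "awalk u (take k C) (awlast u (take k C))" "awalk (awlast u (take k C)) (drop k C) u"
    unfolding awalk_append_iff by blast+
  then have "awalk (awlast u (take k C)) (drop k C @ take k C) (awlast u (take k C))"
    by (intro awalk_appendI)
  then show ?thesis
    unfolding rotate_drop_take k_def by blast
qed

lemma walk_slack_eq:
  assumes "pre_digraph.awalk (constraint_graph A' B') u p v"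
  shows "walk_slack \<sigma> p = potential \<sigma> v - potential \<sigma> u + walk_weight p"
proof -
  interpret wf_digraph "constraint_graph A' B'"
    by (rule wf_constraint_graph)
  from assms show ?thesis
    by (induction p arbitrary: u)
      (auto simp: awalk_Cons_iff awalk_Nil_iff slack_def walk_weight_def)
qed

text \<open>Adding the constraints along \<open>p\<close> cancels every inner vertex.\<close>

lemma slack_summary_constr:
  assumes "pre_digraph.awalk (constraint_graph A' B') u p v" and "p \<noteq> []"
  shows "slack \<sigma> (summary_constr p) = walk_slack \<sigma> p"
proof -
  interpret wf_digraph "constraint_graph A' B'"
    by (rule wf_constraint_graph)
  show ?thesis
    using awalk_endpoints[OF assms] walk_slack_eq[OF assms(1)]
    by (simp add: slack_def summary_constr_def)
qed

text \<open>Both pieces share their two end vertices, so facts about the ends of one piece transfer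
  to the other.\<close>

lemma splits_cycle_awalk:
  assumes "wf_digraph.closed_w (constraint_graph A' B') C" and "splits_cycle C p q"
  obtains u v where "pre_digraph.awalk (constraint_graph A' B') u p v"
    and "pre_digraph.awalk (constraint_graph A' B') v q u"
proof -
  interpret wf_digraph "constraint_graph A' B'"
    by (rule wf_constraint_graph)
  from assms(2) obtain m where "rotate m C = p @ q"
    by (auto simp: splits_cycle_def)
  with closed_w_rotate[OF assms(1), of m] show ?thesis
    using that by auto
qed

section \<open>Cyclic splittings and maximal paths\<close>

lemma splits_cycle_set: "splits_cycle C p q \<Longrightarrow> set C = set p \<union> set q"
  unfolding splits_cycle_def by (metis set_append set_rotate)

lemma splits_cycle_length: "splits_cycle C p q \<Longrightarrow> length C = length p + length q"
  unfolding splits_cycle_def by (metis length_append length_rotate)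

lemma walk_weight_append: "walk_weight (p @ q) = walk_weight p + walk_weight q"
  by (simp add: walk_weight_def)

lemma walk_weight_rotate: "walk_weight (rotate m C) = walk_weight C"
  unfolding rotate_drop_take
  by (metis add.commute append_take_drop_id walk_weight_append)

lemma splits_cycle_swap: "splits_cycle C p q \<Longrightarrow> splits_cycle C q p"
  unfolding splits_cycle_def by (metis rotate_append rotate_rotate)

lemma splits_cycle_shift:
  assumes "splits_cycle C (p @ q) r"
  shows "splits_cycle C q (r @ p)"
  using assms unfolding splits_cycle_def by (metis append.assoc rotate_append rotate_rotate)

text \<open>Being a contiguous piece of \<open>C\<close>, such a path uses only arcs of
  \<open>C\<close> and is no longer than \<open>C\<close>.\<close>

lemma finite_maximal_A_paths: "finite {p. maximal_A_path C p}"
proof (rule finite_subset)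
  show "{p. maximal_A_path C p} \<subseteq> {p. set p \<subseteq> set C \<and> length p \<le> length C}"
    by (auto simp: maximal_A_path_def dest: splits_cycle_set splits_cycle_length)
  show "finite {p. set p \<subseteq> set C \<and> length p \<le> length C}"
    by (rule finite_lists_length_le) simp
qed

text \<open>
  A stretch of the cycle delimited by \<open>B\<close>-arcs splits into \<open>B\<close>-arcs and maximal \<open>A\<close>-paths: an
  \<open>A\<close>-run inside it is cut off by \<open>B\<close>-arcs on both sides.
\<close>
lemma walk_slack_nonneg:
  assumes B_slack: "\<And>e. e \<in> set C \<Longrightarrow> fst e = From_B \<Longrightarrow> 0 \<le> slack \<sigma> (snd e)"
    and A_slack: "\<And>p. maximal_A_path C p \<Longrightarrow> 0 \<le> walk_slack \<sigma> p"
    and "splits_cycle C p q" and "p \<noteq> []"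
    and "fst (hd p) = From_B" and "fst (last p) = From_B"
  shows "0 \<le> walk_slack \<sigma> p"
  using assms(3-)
\<comment> \<open>Arcs peeled off the front of \<open>p\<close> move into the remainder, so
  \<open>q\<close> has to vary as well.\<close>
proof (induction "length p" arbitrary: p q rule: less_induct)
  case less
  then obtain b p' where p: "p = b # p'" and b: "fst b = From_B"
    by (cases p) auto
  have b_nonneg: "0 \<le> slack \<sigma> (snd b)"
    using B_slack b splits_cycle_set[OF less.prems(1)] p by auto
  show ?case
  proof (cases "p' = []")
    case True
    with b_nonneg p show ?thesis by simp
  next
    case False
    \<comment> \<open>After the leading B-arc \<open>b\<close> comes a possibly empty A-run
      \<open>a\<close>; the rest \<open>r\<close> starts at the next B-arc, which exists because
      \<open>p'\<close> ends with one.\<close>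
    define a where "a = takeWhile (\<lambda>e. fst e = From_A) p'"
    define r where "r = dropWhile (\<lambda>e. fst e = From_A) p'"
    have p': "p' = a @ r"
      by (simp add: a_def r_def)
    have "fst (last p') = From_B"
      using less.prems(4) False p by simp
    then have "r \<noteq> []"
      using last_in_set[OF False] by (force simp: r_def dropWhile_eq_Nil_conv)
    then have "fst (hd r) \<noteq> From_A"
      unfolding r_def by (rule hd_dropWhile)
    then have hd_r: "fst (hd r) = From_B"
      by (cases "fst (hd r)") auto
    have last_r: "fst (last r) = From_B"
      using \<open>fst (last p') = From_B\<close> \<open>r \<noteq> []\<close> p' by simp
    have "splits_cycle C r (q @ b # a)"
      using splits_cycle_shift[of C "b # a" r q] less.prems(1) p p' by simp
    then have r_nonneg: "0 \<le> walk_slack \<sigma> r"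
      using less.hyps[of r] p p' \<open>r \<noteq> []\<close> hd_r last_r by simp
    have "0 \<le> walk_slack \<sigma> a"
    proof (cases "a = []")
      case True
      then show ?thesis by simp
    next
      case False
      \<comment> \<open>With the cycle started at \<open>a\<close>, the remainder is
        \<open>r @ q @ [b]\<close>. It begins with the B-arc \<open>hd r\<close> and ends with the
        B-arc \<open>b\<close>, which makes \<open>a\<close> maximal.\<close>
      have "splits_cycle C (a @ r) (q @ [b])"
        using splits_cycle_shift[of C "[b]" "a @ r" q] less.prems(1) p p' by simp
      then have "splits_cycle C a (r @ q @ [b])"
        by (simp add: splits_cycle_def)
      moreover have "\<forall>e\<in>set a. fst e = From_A"
        unfolding a_def by (auto dest: set_takeWhileD)
      ultimately have "maximal_A_path C a"
        unfolding maximal_A_path_def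
        using False \<open>r \<noteq> []\<close> hd_r b by (intro conjI exI[of _ "r @ q @ [b]"]) auto
      then show ?thesis by (rule A_slack)
    qed
    with b_nonneg r_nonneg p p' show ?thesis by simp
  qed
qed

section \<open>Interpolant properties along the cycle\<close>

lemma maximal_A_path_summary:
  assumes closed: "wf_digraph.closed_w (constraint_graph (encode A) (encode B)) C"
    and "maximal_A_path C p"
  shows "slack \<sigma> (summary_constr p) = walk_slack \<sigma> p"
    and "models \<sigma> A \<Longrightarrow> 0 \<le> walk_slack \<sigma> p"
    and "cvars (Upsilon_constr (summary_constr p)) \<subseteq> vars A \<inter> vars B"
proof -
  interpret wf_digraph "constraint_graph (encode A) (encode B)"
    by (rule wf_constraint_graph)
  obtain q where p: "p \<noteq> []" "\<forall>e\<in>set p. fst e = From_A" and split: "splits_cycle C p q"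
    and q: "q \<noteq> []" "fst (hd q) = From_B" "fst (last q) = From_B"
    using assms(2) by (auto simp: maximal_A_path_def)
  obtain u v where puv: "awalk u p v" and qvu: "awalk v q u"
    using splits_cycle_awalk[OF closed split] .
  show "slack \<sigma> (summary_constr p) = walk_slack \<sigma> p"
    using puv p(1) by (rule slack_summary_constr)
  have A: "snd e \<in> encode A" if "e \<in> set p" for e
    using that p(2) puv by (fastforce simp: awalk_def)
  show "0 \<le> walk_slack \<sigma> p" if "models \<sigma> A"
    using A slack_encode_nonneg[OF that] by (auto intro!: sum_list_nonneg)
  have B: "snd e \<in> encode B" if "e \<in> set q" "fst e = From_B" for e
    using that qvu by (auto simp: awalk_def)
  \<comment> \<open>Each end of \<open>p\<close> touches an A-arc of \<open>p\<close> and a B-arc of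
    \<open>q\<close>, hence its variable occurs on both sides.\<close>
  have "source (snd (hd p)) = u" "target (snd (last p)) = v"
    "source (snd (hd q)) = v" "target (snd (last q)) = u"
    using awalk_endpoints[OF puv p(1)] awalk_endpoints[OF qvu q(1)] by simp_all
  then have "var_of (Upsilon_var w) \<in> vars A \<inter> vars B" if "w \<in> {u, v}" for w
    using that vars_encode[OF A[OF hd_in_set[OF p(1)]]] vars_encode[OF A[OF last_in_set[OF p(1)]]]
      vars_encode[OF B[OF hd_in_set[OF q(1)] q(2)]] vars_encode[OF B[OF last_in_set[OF q(1)] q(3)]]
    by auto
  then show "cvars (Upsilon_constr (summary_constr p)) \<subseteq> vars A \<inter> vars B"
    using \<open>source (snd (hd p)) = u\<close> \<open>target (snd (last p)) = v\<close>
    by (simp add: summary_constr_def)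
qed

lemma interpolant_with_B_unsat:
  assumes closed: "wf_digraph.closed_w (constraint_graph (encode A) (encode B)) C"
    and weight: "walk_weight C = 0"
    and split: "splits_cycle C P Q"
    and P: "pre_digraph.awalk (constraint_graph (encode A) (encode B)) (Minus x) P (Plus x)"
    and odd: "odd (walk_weight P)"
    and x: "x \<notin> vars A"
    and B: "models \<sigma> B"
    and I: "\<And>p. maximal_A_path C p \<Longrightarrow> 0 \<le> walk_slack \<sigma> p"
  shows False
proof -
  interpret wf_digraph "constraint_graph (encode A) (encode B)"
    by (rule wf_constraint_graph)
  have "P \<noteq> []"
    using odd by (auto simp: walk_weight_def)
  obtain u v where "awalk u P v" "awalk v Q u"
    using splits_cycle_awalk[OF closed split] .
  \<comment> \<open>A nonempty walk determines its ends, so \<open>u\<close> and \<open>v\<close>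
    are \<open>Minus x\<close> and \<open>Plus x\<close>, and \<open>Q\<close> leads back.\<close>
  with awalk_endpoints[OF P \<open>P \<noteq> []\<close>] have Q: "awalk (Plus x) Q (Minus x)"
    using awalk_endpoints[OF \<open>awalk u P v\<close> \<open>P \<noteq> []\<close>] by simp
  then have "Q \<noteq> []"
    by (auto simp: awalk_Nil_iff)
  \<comment> \<open>An A-arc at \<open>Plus x\<close> or \<open>Minus x\<close> would come from a
    constraint of \<open>A\<close> that mentions \<open>x\<close>.\<close>
  have side: "fst e = From_B" if "e \<in> set P \<union> set Q"
    "x \<in> {var_of (Upsilon_var (source (snd e))), var_of (Upsilon_var (target (snd e)))}" for e
    using that x P Q vars_encode[of "snd e" A] by (auto simp: awalk_def)
  have B_slack: "0 \<le> slack \<sigma> (snd e)" if "e \<in> set C" "fst e = From_B" for e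
    using that P Q splits_cycle_set[OF split] slack_encode_nonneg[OF B, of "snd e"]
    by (auto simp: awalk_def)
  have "0 \<le> walk_slack \<sigma> P"
    by (rule walk_slack_nonneg[OF B_slack I split \<open>P \<noteq> []\<close>])
      (use \<open>P \<noteq> []\<close> awalk_endpoints[OF P \<open>P \<noteq> []\<close>] in \<open>auto intro!: side\<close>)
  moreover have "0 \<le> walk_slack \<sigma> Q"
    by (rule walk_slack_nonneg[OF B_slack I splits_cycle_swap[OF split] \<open>Q \<noteq> []\<close>])
      (use \<open>Q \<noteq> []\<close> awalk_endpoints[OF Q \<open>Q \<noteq> []\<close>] in \<open>auto intro!: side\<close>)
  moreover have "walk_weight P + walk_weight Q = 0"
  proof -
    obtain m where "rotate m C = P @ Q"
      using split by (auto simp: splits_cycle_def)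
    then have "walk_weight P + walk_weight Q = walk_weight (rotate m C)"
      by (simp add: walk_weight_append)
    with weight show ?thesis
      by (simp add: walk_weight_rotate)
  qed
  \<comment> \<open>The slacks of \<open>P\<close> and \<open>Q\<close> are nonnegative and sum to
    the cycle weight 0, so both vanish.\<close>
  ultimately have "walk_weight P = 2 * (- \<sigma> x)"
    using walk_slack_eq[OF P, of \<sigma>] walk_slack_eq[OF Q, of \<sigma>] by simp
  with odd show False by simp
qed

theorem mainTheorem8:
  fixes A B :: "'a constr set"
    and A' B' :: "'a dconstr set"
    and G :: "('a dvar, 'a arc) pre_digraph"
    and C P :: "'a arc list"
    and x :: 'a
    and I' :: "'a dconstr set"
    and I :: "'a constr set"
  assumes "finite A" and "finite B"
    and "\<forall>c\<in>A \<union> B. utvpi c"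
    and "\<exists>\<sigma> :: 'a \<Rightarrow> rat. models \<sigma> (A \<union> B)"
    and "\<not> (\<exists>\<sigma> :: 'a \<Rightarrow> int. models \<sigma> (A \<union> B))"
    and "A' = encode A" and "B' = encode B"
    and "G = constraint_graph A' B'"
    and "wf_digraph.closed_w G C"
    and "walk_weight C = 0"
    and "visits_once C (Plus x)" and "visits_once C (Minus x)"
    and "\<exists>Q. splits_cycle C P Q"
    and "pre_digraph.awalk G (Minus x) P (Plus x)"
    and "odd (walk_weight P)"
    and "x \<in> vars B" and "x \<notin> vars A"
    and "I' = {summary_constr p | p. maximal_A_path C p}"
    and "I = Upsilon I'"
  shows "int_interpolant A B I"
proof -
  have closed: "wf_digraph.closed_w (constraint_graph (encode A) (encode B)) C"
    using assms by simp
  note summary = maximal_A_path_summary[OF closed]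
  obtain Q where split: "splits_cycle C P Q"
    using assms by blast
  have P: "pre_digraph.awalk (constraint_graph (encode A) (encode B)) (Minus x) P (Plus x)"
    using assms by simp
  have I: "I = (Upsilon_constr \<circ> summary_constr) ` {p. maximal_A_path C p}"
    using assms by (auto simp: Upsilon_def)
  \<comment> \<open>Entailment by \<open>A\<close> and inconsistency with \<open>B\<close> are both
    read off from this description of the models of \<open>I\<close>.\<close>
  have models_I: "models \<sigma> I \<longleftrightarrow> (\<forall>p. maximal_A_path C p \<longrightarrow> 0 \<le> walk_slack \<sigma> p)" for \<sigma>
    by (auto simp: I models_def holds_Upsilon_constr_iff summary(1))
  have "finite I"
    unfolding I by (intro finite_imageI finite_maximal_A_paths)
  moreover have "models \<sigma> I" if "models \<sigma> A" for \<sigma> :: "'a \<Rightarrow> int"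
    using summary(2)[OF _ that] by (simp add: models_I)
  moreover have False if "models \<sigma> (I \<union> B)" for \<sigma> :: "'a \<Rightarrow> int"
  proof (rule interpolant_with_B_unsat[OF closed \<open>walk_weight C = 0\<close> split P
        \<open>odd (walk_weight P)\<close> \<open>x \<notin> vars A\<close>])
    show "models \<sigma> B"
      using that by (simp add: models_def)
    have "models \<sigma> I"
      using that by (simp add: models_def)
    then show "0 \<le> walk_slack \<sigma> p" if "maximal_A_path C p" for p
      using that by (simp add: models_I)
  qed
  moreover have "vars I \<subseteq> vars A \<inter> vars B"
    unfolding I vars_def[of "_ ` _"] using summary(3) by fastforce
  ultimately show ?thesis
    unfolding int_interpolant_def by blast
qed

end
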